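(* If the statement $\Phi_4$ holds, then there are infinitely many positive integers $m$ such that $m!+1$ is prime.
   Context: Define $f:\{1,2,3,\ldots\}\to\mathbb{N}$ by $f(1)=2$, $f(2)=3$, and $f(n+1)=f(n)!$ for every integer $n\geqslant 2$. Write $x\not\mid y$ to mean that $x$ does not divide $y$. For a positive integer $n$, $\Phi_n$ denotes the statement: for every system $\mathcal{S}$ that is a subset of $\{x_i+1=x_k,\ x_i!=x_k,\ x_i\not\mid x_k : i,k\in\{1,\ldots,n\}\}$, if $\mathcal{S}$ has only finitely many solutions in positive integers $x_1,\ldots,x_n$, then every such solution $(x_1,\ldots,x_n)$ satisfies $x_1,\ldots,x_n\leqslant f(n)$. *)

theory Defs
  imports Complex_Main "HOL-Library.FuncSet" "HOL-Computational_Algebra.Primes"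
begin

(* The function is only meaningful on positive arguments; its value at 0 is a dummy. *)
fun f :: "nat \<Rightarrow> nat" where
  "f 0 = 0"
| "f (Suc 0) = 2"
| "f (Suc (Suc 0)) = 3"
| "f (Suc (Suc (Suc n))) = fact (f (Suc (Suc n)))"

(* Formal constraints between the variables x_i and x_k:
   Succ_eq i k is x_i + 1 = x_k, Fact_eq i k is x_i! = x_k,
   Not_dvd i k is "x_i does not divide x_k". *)
datatype constraint = Succ_eq nat nat | Fact_eq nat nat | Not_dvd nat nat

fun holds :: "(nat \<Rightarrow> nat) \<Rightarrow> constraint \<Rightarrow> bool" where
  "holds x (Succ_eq i k) \<longleftrightarrow> x i + 1 = x k"
| "holds x (Fact_eq i k) \<longleftrightarrow> fact (x i) = x k"
| "holds x (Not_dvd i k) \<longleftrightarrow> \<not> x i dvd x k"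

definition constraints :: "nat \<Rightarrow> constraint set" where
  "constraints n =
     {Succ_eq i k | i k. i \<in> {1..n} \<and> k \<in> {1..n}} \<union>
     {Fact_eq i k | i k. i \<in> {1..n} \<and> k \<in> {1..n}} \<union>
     {Not_dvd i k | i k. i \<in> {1..n} \<and> k \<in> {1..n}}"

(* A tuple (x_1, ..., x_n) of positive integers is an extensional function on {1..n}
   (fixed outside that set), so that counting functions is counting tuples. *)
definition solutions :: "nat \<Rightarrow> constraint set \<Rightarrow> (nat \<Rightarrow> nat) set" where
  "solutions n S = {x \<in> {1..n} \<rightarrow>\<^sub>E {0<..}. \<forall>c\<in>S. holds x c}"

definition Phi :: "nat \<Rightarrow> bool" where
  "Phi n \<longleftrightarrow>
     (\<forall>S. S \<subseteq> constraints n \<longrightarrow> finite (solutions n S) \<longrightarrow>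
        (\<forall>x \<in> solutions n S. \<forall>i \<in> {1..n}. x i \<le> f n))"

end

theory Submission
  imports Defs "HOL-Number_Theory.Pocklington" "HOL-Number_Theory.Mod_Exp"
begin

text \<open>
  By the converse of Wilson's theorem, \<open>n = m! + 1\<close> is prime iff it does not divide
  \<open>(n - 1)! = (m!)!\<close>; the exception \<open>n = 4\<close> does not occur, as \<open>3\<close> is not a factorial. Hence the
  system \<open>x\<^sub>1! = x\<^sub>2\<close>, \<open>x\<^sub>2 + 1 = x\<^sub>3\<close>, \<open>x\<^sub>2! = x\<^sub>4\<close>, \<open>\<not> x\<^sub>3 dvd x\<^sub>4\<close> has exactly one solution
  for each \<open>m = x\<^sub>1\<close> with \<open>m! + 1\<close> prime. Since \<open>11! + 1\<close> is prime and exceeds \<open>f 4 = 720\<close>, the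
  statement \<open>Phi 4\<close> forces infinitely many solutions.
\<close>

text \<open>The factor \<open>a\<close> already divides \<open>fact (b - 1)\<close>, and
  \<open>b\<close> is the next factor of the factorial.\<close>

lemma mult_dvd_fact:
  fixes a b k :: nat
  assumes "0 < a" "a < b" "b \<le> k"
  shows "a * b dvd fact k"
proof -
  have "a dvd fact (b - 1)"
    using assms by (intro dvd_fact) auto
  hence "a * b dvd fact b"
    using assms by (subst fact_reduce) (auto simp: mult.commute[of a])
  thus ?thesis
    using assms(3) fact_dvd dvd_trans by blast
qed

lemma dvd_fact_pred_if_not_prime:
  fixes n :: nat
  assumes "1 < n" "n \<noteq> 4" "\<not> prime n"
  shows "n dvd fact (n - 1)"
proof -
  obtain a where a: "a dvd n" "a \<noteq> 1" "a \<noteq> n"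
    using assms(1,3) by (auto simp: prime_nat_iff)
  then obtain b where b: "n = a * b" by blast
  with a assms(1) have ab: "1 < a" "1 < b"
    by (auto intro!: Suc_lessI Nat.gr0I)
  have "a * 1 < a * b" "1 * b < a * b"
    using ab by simp_all
  hence le: "a \<le> n - 1" "b \<le> n - 1"
    using b by linarith+
  show ?thesis
  proof (cases "a = b")
    case False
    thus ?thesis
      using ab le mult_dvd_fact[of a b "n - 1"] mult_dvd_fact[of b a "n - 1"] unfolding b
      by (cases a b rule: linorder_cases) (simp_all add: mult.commute)
  next
    case True
    with b assms(2) have "a \<noteq> 2" by auto
    with ab have "2 < a" by simp
    \<comment> \<open>For a square \<open>n = a * a\<close>, the two distinct factors of the
      factorial are \<open>a\<close> and \<open>2 * a\<close>; the bound needs \<open>2 < a\<close>,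
      hence the exclusion of 4.\<close>
    hence "2 * a < n"
      using True b by simp
    hence "2 * a \<le> n - 1"
      by linarith
    hence "a * (2 * a) dvd fact (n - 1)"
      using ab by (intro mult_dvd_fact) auto
    moreover have "n dvd a * (2 * a)"
      using True b by simp
    ultimately show ?thesis
      by (rule dvd_trans[rotated])
  qed
qed

lemma fact_neq_3: "fact m \<noteq> (3 :: nat)"
proof
  assume m: "fact m = (3 :: nat)"
  show False
  proof (cases "m < 2")
    case True
    with m show False by (auto simp: less_2_cases_iff)
  next
    case False
    hence "2 dvd (fact m :: nat)" by (intro dvd_fact) auto
    with m show False by simp
  qed
qed

lemma prime_fact_plus_1_if_not_dvd:
  assumes "\<not> fact m + 1 dvd (fact (fact m) :: nat)"
  shows "prime (fact m + 1 :: nat)"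
  using dvd_fact_pred_if_not_prime[of "fact m + 1"] assms fact_neq_3[of m] by force

lemma prime_dvd_6400:
  fixes p :: nat
  assumes "prime p" "p dvd 6400"
  shows "p = 2 \<or> p = 5"
proof -
  have "(6400 :: nat) = 2 ^ 8 * 5 ^ 2" by simp
  with assms have "p dvd 2 ^ 8 \<or> p dvd 5 ^ 2"
    by (simp only: prime_dvd_mult_iff)
  hence "p dvd 2 \<or> p dvd 5"
    using assms(1) prime_dvd_power by blast
  moreover have "prime (2 :: nat)" "prime (5 :: nat)"
    by simp_all
  ultimately show ?thesis
    using assms(1) primes_dvd_imp_eq by blast
qed

text \<open>
  Pocklington's criterion with witness 13 and the part \<open>6400 = 2\<^sup>8 * 5\<^sup>2\<close> of
  \<open>39916800 = 11!\<close>, which exceeds the square root of 39916801. Calling the simplifier on the goal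
  itself would start trial division.
\<close>
lemma prime_39916801: "prime (39916801 :: nat)"
proof (rule pocklington_alt[where a = 13 and q = 6400 and r = 6237])
  show "[13 ^ (39916801 - 1) = 1] (mod (39916801 :: nat))"
    unfolding cong_power_nat_code by simp
  show "\<forall>p. prime p \<and> p dvd 6400 \<longrightarrow>
          (\<exists>b. [13 ^ ((39916801 - 1) div p) = b] (mod (39916801 :: nat)) \<and> coprime (b - 1) 39916801)"
  proof (intro allI impI)
    fix p :: nat
    assume "prime p \<and> p dvd 6400"
    then consider "p = 2" | "p = 5"
      using prime_dvd_6400 by blast
    thus "\<exists>b. [13 ^ ((39916801 - 1) div p) = b] (mod (39916801 :: nat)) \<and> coprime (b - 1) 39916801"
    proof cases
      case 1
      show ?thesis
        unfolding 1 cong_power_nat_code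
        \<comment> \<open>The residue is -1 modulo 39916801.\<close>
        by (rule exI[of _ 39916800]) (simp add: coprime_iff_gcd_eq_1 gcd_non_0_nat)
    next
      case 2
      show ?thesis
        unfolding 2 cong_power_nat_code
        \<comment> \<open>The residue of \<open>13 ^ (39916800 div 5)\<close>, a fifth root of unity
          other than 1.\<close>
        by (rule exI[of _ 26212424]) (simp add: coprime_iff_gcd_eq_1 gcd_non_0_nat)
    qed
  qed
qed simp_all

definition fact_prime_system :: "constraint set" where
  "fact_prime_system = {Fact_eq 1 2, Succ_eq 2 3, Fact_eq 2 4, Not_dvd 3 4}"

definition fact_prime_solution :: "nat \<Rightarrow> nat \<Rightarrow> nat" where
  "fact_prime_solution m =
     (\<lambda>i\<in>{1..4}. if i = 1 then m else if i = 2 then fact m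
        else if i = 3 then fact m + 1 else fact (fact m))"

lemma atLeastAtMost_1_4: "{1..4} = {1, 2, 3, 4 :: nat}"
  by auto

lemma fact_prime_system_subset: "fact_prime_system \<subseteq> constraints 4"
  unfolding fact_prime_system_def constraints_def by auto

text \<open>The coordinate \<open>x 1\<close> determines the other three, so finitely many such
  \<open>m\<close> leave only finitely many solutions.\<close>

lemma solutions_fact_prime_system_subset:
  "solutions 4 fact_prime_system \<subseteq>
     fact_prime_solution ` {m. 0 < m \<and> prime (fact m + 1 :: nat)}"
proof
  fix x assume x: "x \<in> solutions 4 fact_prime_system"
  hence eqs: "x 2 = fact (x 1)" "x 3 = fact (x 1) + 1" "x 4 = fact (fact (x 1))"
    and ndvd: "\<not> x 3 dvd x 4" and pos: "0 < x 1" and ext: "x \<in> extensional {1..4}"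
    by (auto simp: solutions_def fact_prime_system_def PiE_iff)
  have "x = fact_prime_solution (x 1)"
  proof (rule extensionalityI[OF ext])
    show "x i = fact_prime_solution (x 1) i" if "i \<in> {1..4}" for i
      using that eqs unfolding atLeastAtMost_1_4 by (auto simp: fact_prime_solution_def)
  qed (simp add: fact_prime_solution_def)
  moreover have "prime (fact (x 1) + 1 :: nat)"
    using prime_fact_plus_1_if_not_dvd ndvd eqs by metis
  ultimately show "x \<in> fact_prime_solution ` {m. 0 < m \<and> prime (fact m + 1 :: nat)}"
    using pos by blast
qed

lemma fact_prime_solution_in_solutions:
  assumes "0 < m" "prime (fact m + 1 :: nat)"
  shows "fact_prime_solution m \<in> solutions 4 fact_prime_system"
proof -
  have "\<not> fact m + 1 dvd (fact (fact m) :: nat)"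
    \<comment> \<open>A prime divides \<open>fact k\<close> only if it is at most \<open>k\<close>,
      and here it is \<open>k + 1\<close>.\<close>
    using assms(2) by (subst prime_dvd_fact_iff) auto
  thus ?thesis
    using assms(1)
    by (auto simp: solutions_def fact_prime_system_def fact_prime_solution_def PiE_iff)
qed

theorem theorem1:
  assumes "Phi 4"
  shows "infinite {m::nat. 0 < m \<and> prime (fact m + 1 :: nat)}"
proof
  assume "finite {m::nat. 0 < m \<and> prime (fact m + 1 :: nat)}"
  hence "finite (solutions 4 fact_prime_system)"
    using solutions_fact_prime_system_subset finite_surj by blast
  hence le: "fact_prime_solution m i \<le> f 4"
    if "0 < m" "prime (fact m + 1 :: nat)" "i \<in> {1..4}" for m i
    using assms fact_prime_system_subset fact_prime_solution_in_solutions that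
    unfolding Phi_def by blast
  have fact_11: "fact 11 + 1 = (39916801 :: nat)"
    by (simp add: fact_numeral)
  have "fact_prime_solution 11 3 \<le> f 4"
    by (rule le) (simp_all only: fact_11 prime_39916801, simp_all)
  moreover have "fact_prime_solution 11 3 = 39916801"
    by (simp add: fact_prime_solution_def fact_numeral)
  moreover have "f 4 = 720"
    using f.simps(4)[of 0] f.simps(4)[of 1] f.simps(3)
    by (simp add: numeral_2_eq_2[symmetric] numeral_3_eq_3[symmetric] fact_numeral)
  ultimately show False
    by simp
qed

end
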